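(* Let $\phi:\mathbb R\to[0,+\infty]$ be an Orlicz function with $ces_\phi\neq\{0\}$. Then $ces_\phi$ equipped with the Luxemburg norm $\|\cdot\|_\phi$ is a Banach space.
   Context: A map $\phi:\mathbb R\to[0,+\infty]$ is an Orlicz function if it is even, convex, left continuous on $\mathbb R_+=[0,\infty)$, continuous at zero, $\phi(0)=0$ and $\phi(u)\to\infty$ as $u\to\infty$ (the value $+\infty$ is allowed). Let $l^0$ be the space of all real sequences $x=(x(i))_{i=1}^\infty$. For $x\in l^0$ put $\sigma x(i)=\frac1i\sum_{j=1}^i|x(j)|$ and $\rho_\phi(x)=\sum_{i=1}^\infty\phi(\sigma x(i))$. The Cesàro–Orlicz sequence space is $ces_\phi=\{x\in l^0:\ \rho_\phi(\lambda x)<\infty\text{ for some }\lambda>0\}$, equipped with the Luxemburg norm $\|x\|_\phi=\inf\{\lambda>0:\rho_\phi(x/\lambda)\le1\}$. *)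

theory Defs
  imports "HOL-Analysis.Analysis" "HOL-Library.Function_Algebras"
begin

(* The extended half-line [0, +infinity] is the type ennreal, in which 0 * \<infinity> = 0. *)
definition orlicz_function :: "(real \<Rightarrow> ennreal) \<Rightarrow> bool" where
  "orlicz_function \<phi> \<longleftrightarrow>
     (\<forall>u. \<phi> (- u) = \<phi> u) \<and>
     (\<forall>u v t. 0 \<le> t \<and> t \<le> 1 \<longrightarrow>
        \<phi> ((1 - t) * u + t * v) \<le> ennreal (1 - t) * \<phi> u + ennreal t * \<phi> v) \<and>
     (\<forall>u\<ge>0. continuous (at u within {0..u}) \<phi>) \<and>
     isCont \<phi> 0 \<and>
     \<phi> 0 = 0 \<and>
     (\<phi> \<longlongrightarrow> \<infinity>) at_top"

(* Sequences are indexed from 0 here, so entry n stands for the mathematical entry n + 1. *)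
definition cesaro_mean :: "(nat \<Rightarrow> real) \<Rightarrow> nat \<Rightarrow> real" where
  "cesaro_mean x n = (\<Sum>j\<le>n. \<bar>x j\<bar>) / real (n + 1)"

definition cesaro_modular :: "(real \<Rightarrow> ennreal) \<Rightarrow> (nat \<Rightarrow> real) \<Rightarrow> ennreal" where
  "cesaro_modular \<phi> x = (\<Sum>n. \<phi> (cesaro_mean x n))"

definition seq_scale :: "real \<Rightarrow> (nat \<Rightarrow> real) \<Rightarrow> nat \<Rightarrow> real" where
  "seq_scale c x = (\<lambda>n. c * x n)"

definition cesaro_orlicz :: "(real \<Rightarrow> ennreal) \<Rightarrow> (nat \<Rightarrow> real) set" where
  "cesaro_orlicz \<phi> = {x. \<exists>l>0. cesaro_modular \<phi> (seq_scale l x) < \<infinity>}"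

(* Meaningful only on cesaro_orlicz \<phi>: elsewhere the set is empty and its real infimum arbitrary. *)
definition luxemburg_norm :: "(real \<Rightarrow> ennreal) \<Rightarrow> (nat \<Rightarrow> real) \<Rightarrow> real" where
  "luxemburg_norm \<phi> x = Inf {l. 0 < l \<and> cesaro_modular \<phi> (seq_scale (1 / l) x) \<le> 1}"

(* The type class banach fixes one norm on a whole type; here the carrier and the norm vary. *)
definition normed_space_on :: "(real \<Rightarrow> 'a \<Rightarrow> 'a) \<Rightarrow> 'a::ab_group_add set \<Rightarrow> ('a \<Rightarrow> real) \<Rightarrow> bool" where
  "normed_space_on smul V N \<longleftrightarrow>
     vector_space smul \<and> module.subspace smul V \<and>
     (\<forall>x\<in>V. 0 \<le> N x) \<and>
     (\<forall>x\<in>V. N x = 0 \<longleftrightarrow> x = 0) \<and>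
     (\<forall>c. \<forall>x\<in>V. N (smul c x) = \<bar>c\<bar> * N x) \<and>
     (\<forall>x\<in>V. \<forall>y\<in>V. N (x + y) \<le> N x + N y)"

definition banach_space_on :: "(real \<Rightarrow> 'a \<Rightarrow> 'a) \<Rightarrow> 'a::ab_group_add set \<Rightarrow> ('a \<Rightarrow> real) \<Rightarrow> bool" where
  "banach_space_on smul V N \<longleftrightarrow>
     normed_space_on smul V N \<and>
     (\<forall>s::nat \<Rightarrow> 'a. (\<forall>k. s k \<in> V) \<and>
        (\<forall>e>0. \<exists>K. \<forall>m\<ge>K. \<forall>n\<ge>K. N (s m - s n) < e) \<longrightarrow>
        (\<exists>x\<in>V. (\<lambda>k. N (s k - x)) \<longlonglongrightarrow> 0))"

end

theory Submission
  imports Defs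
begin

text \<open>
  Since \<open>\<phi>\<close> is convex, vanishes at 0 and increases on the half-line, the modular is convex and
  monotone, which gives the norm axioms. For completeness, choose \<open>u\<close> with \<open>\<phi> u > 1\<close>: if the modular
  of \<open>z / l\<close> is at most 1, then every Cesaro mean of \<open>z\<close> is at most \<open>u * l\<close>. Hence coordinates are
  controlled by the norm and a Cauchy sequence converges pointwise. Losing a factor 2
  in the norm, the bound on the modular passes to the pointwise limit by monotonicity of \<open>\<phi>\<close> alone,
  with no appeal to its left continuity.
\<close>

section \<open>Cesaro means and scaling of sequences\<close>

lemma cesaro_mean_nonneg: "0 \<le> cesaro_mean x n"
  unfolding cesaro_mean_def by (simp add: sum_nonneg)

lemma cesaro_mean_scale: "cesaro_mean (seq_scale c x) n = \<bar>c\<bar> * cesaro_mean x n"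
  unfolding cesaro_mean_def seq_scale_def by (simp add: abs_mult sum_distrib_left)

lemma cesaro_mean_add_le: "cesaro_mean (x + y) n \<le> cesaro_mean x n + cesaro_mean y n"
proof -
  have "(\<Sum>j\<le>n. \<bar>(x + y) j\<bar>) \<le> (\<Sum>j\<le>n. \<bar>x j\<bar>) + (\<Sum>j\<le>n. \<bar>y j\<bar>)"
    unfolding sum.distrib[symmetric] by (intro sum_mono) (simp add: abs_triangle_ineq)
  then show ?thesis
    unfolding cesaro_mean_def by (simp add: add_divide_distrib[symmetric] divide_right_mono)
qed

lemma abs_le_cesaro_mean: "\<bar>x n\<bar> \<le> real (n + 1) * cesaro_mean x n"
proof -
  have "\<bar>x n\<bar> \<le> (\<Sum>j\<le>n. \<bar>x j\<bar>)"
    by (rule member_le_sum) auto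
  then show ?thesis
    unfolding cesaro_mean_def by simp
qed

lemma tendsto_cesaro_mean:
  assumes "\<And>j. ((\<lambda>k. s k j) \<longlongrightarrow> x j) F"
  shows "((\<lambda>k. cesaro_mean (s k) n) \<longlongrightarrow> cesaro_mean x n) F"
  unfolding cesaro_mean_def by (intro tendsto_intros assms) simp

lemma seq_scale_scale: "seq_scale a (seq_scale b x) = seq_scale (a * b) x"
  by (simp add: seq_scale_def mult.assoc)

lemma seq_scale_one: "seq_scale 1 x = x"
  by (simp add: seq_scale_def)

lemma vector_space_seq_scale: "vector_space seq_scale"
  by standard (auto simp: seq_scale_def fun_eq_iff algebra_simps)

lemma module_seq_scale: "module seq_scale"
  using vector_space_seq_scale by (simp add: vector_space_def module_def)

locale orlicz =
  fixes \<phi> :: "real \<Rightarrow> ennreal"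
  assumes orlicz: "orlicz_function \<phi>"
begin

abbreviation "M \<equiv> cesaro_modular \<phi>"
abbreviation "V \<equiv> cesaro_orlicz \<phi>"
abbreviation "N \<equiv> luxemburg_norm \<phi>"

section \<open>Monotonicity and growth of an Orlicz function\<close>

lemma phi_zero: "\<phi> 0 = 0"
  using orlicz by (simp add: orlicz_function_def)

lemma phi_convex:
  assumes "0 \<le> a" "0 \<le> b" "a + b = 1"
  shows "\<phi> (a * u + b * v) \<le> ennreal a * \<phi> u + ennreal b * \<phi> v"
proof -
  have "a = 1 - b" "b \<le> 1"
    using assms by linarith+
  then show ?thesis
    using orlicz assms(2) unfolding orlicz_function_def by simp
qed

text \<open>For \<open>0 < v\<close> the point \<open>u\<close> is a convex combination of
  \<open>0\<close> and \<open>v\<close> with weight \<open>u / v\<close>, and the term at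
  \<open>0\<close> vanishes because \<open>\<phi> 0 = 0\<close>.\<close>

lemma phi_mono:
  assumes "0 \<le> u" "u \<le> v"
  shows "\<phi> u \<le> \<phi> v"
proof (cases "v = 0")
  case True
  then show ?thesis using assms by simp
next
  case False
  with assms have "0 < v" by simp
  define t where "t = u / v"
  have t: "0 \<le> t" "t \<le> 1" "u = (1 - t) * 0 + t * v"
    using assms \<open>0 < v\<close> by (auto simp: t_def)
  have "\<phi> u \<le> ennreal (1 - t) * \<phi> 0 + ennreal t * \<phi> v"
    using phi_convex[of "1 - t" t 0 v] t by simp
  also have "\<dots> = ennreal t * \<phi> v"
    by (simp add: phi_zero)
  also have "\<dots> \<le> 1 * \<phi> v"
    using t by (intro mult_right_mono) auto
  finally show ?thesis by simp
qed

lemma exists_phi_gt_one: "\<exists>u>0. 1 < \<phi> u"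
proof -
  have "(\<phi> \<longlongrightarrow> \<infinity>) at_top"
    using orlicz by (simp add: orlicz_function_def)
  then have "eventually (\<lambda>u. 1 < \<phi> u) at_top"
    by (rule order_tendstoD(1)) simp
  then have "eventually (\<lambda>u. 0 < u \<and> 1 < \<phi> u) at_top"
    using eventually_gt_at_top[of "0::real"] by (rule eventually_conj[rotated])
  then show ?thesis
    using eventually_happens'[OF trivial_limit_at_top_linorder] by blast
qed

section \<open>The modular: convexity and scaling\<close>

lemma modular_zero: "M 0 = 0"
  by (simp add: cesaro_modular_def cesaro_mean_def phi_zero)

text \<open>The Cesaro mean is only subadditive, so monotonicity of \<open>\<phi>\<close> has to
  come before its convexity in each summand.\<close>

lemma modular_convex:
  assumes "0 \<le> a" "0 \<le> b" "a + b = 1"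
  shows "M (seq_scale a x + seq_scale b y) \<le> ennreal a * M x + ennreal b * M y"
proof -
  have "\<phi> (cesaro_mean (seq_scale a x + seq_scale b y) n)
      \<le> ennreal a * \<phi> (cesaro_mean x n) + ennreal b * \<phi> (cesaro_mean y n)" for n
  proof -
    have "cesaro_mean (seq_scale a x + seq_scale b y) n \<le> a * cesaro_mean x n + b * cesaro_mean y n"
      using cesaro_mean_add_le[of "seq_scale a x" "seq_scale b y" n] assms
      by (simp add: cesaro_mean_scale)
    then show ?thesis
      using phi_mono[OF cesaro_mean_nonneg] phi_convex[OF assms] order_trans by blast
  qed
  then have "M (seq_scale a x + seq_scale b y)
      \<le> (\<Sum>n. ennreal a * \<phi> (cesaro_mean x n) + ennreal b * \<phi> (cesaro_mean y n))"
    unfolding cesaro_modular_def by (intro suminf_le summableI)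
  also have "\<dots> = ennreal a * M x + ennreal b * M y"
    unfolding cesaro_modular_def by (simp add: suminf_add[symmetric])
  finally show ?thesis .
qed

lemma modular_scale_le:
  assumes "0 \<le> t" "t \<le> 1"
  shows "M (seq_scale t x) \<le> ennreal t * M x"
  using modular_convex[of t "1 - t" x 0] assms
  by (simp add: modular_zero seq_scale_def plus_fun_def)

lemma modular_scale_abs: "M (seq_scale \<bar>c\<bar> x) = M (seq_scale c x)"
  by (simp add: cesaro_modular_def cesaro_mean_scale)

lemma modular_scale_mono:
  assumes "0 \<le> a" "a \<le> b"
  shows "M (seq_scale a x) \<le> M (seq_scale b x)"
  unfolding cesaro_modular_def using assms
  by (intro suminf_le summableI phi_mono cesaro_mean_nonneg)
    (simp add: cesaro_mean_scale mult_right_mono cesaro_mean_nonneg)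

text \<open>Membership becomes nonemptiness of the set whose infimum defines the norm. A finite
  modular is brought down to at most 1 by shrinking the sequence further, since convexity makes the
  modular shrink at least in proportion.\<close>

lemma cesaro_orlicz_iff: "x \<in> V \<longleftrightarrow> (\<exists>l>0. M (seq_scale (1 / l) x) \<le> 1)"
proof
  assume "x \<in> V"
  then obtain l where l: "0 < l" "M (seq_scale l x) < \<infinity>"
    unfolding cesaro_orlicz_def by auto
  then obtain r where r: "0 \<le> r" "M (seq_scale l x) = ennreal r"
    by (metis ennreal_cases infinity_ennreal_def less_irrefl)
  \<comment> \<open>The \<open>+ 1\<close> covers \<open>r = 0\<close> and keeps \<open>t\<close> at
    most 1, as \<open>modular_scale_le\<close> requires.\<close>
  define t where "t = 1 / (r + 1)"
  have t: "0 < t" "t \<le> 1" "t * r \<le> 1"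
    using r by (auto simp: t_def)
  have "M (seq_scale t (seq_scale l x)) \<le> ennreal t * M (seq_scale l x)"
    using t by (intro modular_scale_le) auto
  also have "\<dots> = ennreal (t * r)"
    using r t by (simp add: ennreal_mult)
  also have "\<dots> \<le> 1"
    using t by simp
  finally have "M (seq_scale (1 / (1 / (t * l))) x) \<le> 1"
    by (simp add: seq_scale_scale)
  moreover have "0 < 1 / (t * l)"
    using t l by simp
  ultimately show "\<exists>l>0. M (seq_scale (1 / l) x) \<le> 1" by blast
next
  assume "\<exists>l>0. M (seq_scale (1 / l) x) \<le> 1"
  then obtain l where "0 < l" "M (seq_scale (1 / l) x) \<le> 1" by auto
  moreover have "(1::ennreal) < \<infinity>" by simp
  ultimately have "0 < 1 / l" "M (seq_scale (1 / l) x) < \<infinity>"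
    by (simp, metis order_le_less_trans)
  then show "x \<in> V" unfolding cesaro_orlicz_def by blast
qed

section \<open>The Luxemburg norm and its axioms\<close>

lemma norm_le:
  assumes "0 < l" "M (seq_scale (1 / l) x) \<le> 1"
  shows "N x \<le> l"
  unfolding luxemburg_norm_def using assms
  by (intro cInf_lower) (auto intro!: bdd_belowI[of _ 0])

lemma norm_nonneg:
  assumes "x \<in> V"
  shows "0 \<le> N x"
  unfolding luxemburg_norm_def
  using assms by (intro cInf_greatest) (auto simp: cesaro_orlicz_iff)

text \<open>The strict inequality yields an admissible \<open>k\<close> below \<open>l\<close>,
  whether or not the infimum is attained; passing from \<open>k\<close> to \<open>l\<close> lowers
  the scaling factor and hence the modular.\<close>

lemma modular_le_one:
  assumes "x \<in> V" "N x < l"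
  shows "M (seq_scale (1 / l) x) \<le> 1"
proof -
  have "{l. 0 < l \<and> M (seq_scale (1 / l) x) \<le> 1} \<noteq> {}"
    using assms(1) by (auto simp: cesaro_orlicz_iff)
  then obtain k where k: "0 < k" "M (seq_scale (1 / k) x) \<le> 1" "k < l"
    using cInf_lessD[OF _ assms(2)[unfolded luxemburg_norm_def]] by auto
  then have "M (seq_scale (1 / l) x) \<le> M (seq_scale (1 / k) x)"
    by (intro modular_scale_mono) (auto simp: frac_le)
  then show ?thesis using k(2) by simp
qed

lemma zero_in_space: "0 \<in> V"
  unfolding cesaro_orlicz_iff
  by (intro exI[of _ 1]) (simp add: seq_scale_one modular_zero)

lemma norm_zero: "N 0 = 0"
proof (rule antisym)
  have "seq_scale a 0 = 0" for a
    by (simp add: seq_scale_def fun_eq_iff)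
  then have "N 0 \<le> l" if "0 < l" for l
    using that by (simp add: norm_le modular_zero)
  then show "N 0 \<le> 0"
    by (rule dense_ge)
qed (rule norm_nonneg[OF zero_in_space])

text \<open>The two scaling factors of \<open>x\<close> agree up to sign, which the modular
  ignores.\<close>

lemma modular_scaled_le_one:
  assumes "c \<noteq> 0" "M (seq_scale (1 / l) x) \<le> 1"
  shows "M (seq_scale (1 / (\<bar>c\<bar> * l)) (seq_scale c x)) \<le> 1"
proof -
  have "\<bar>1 / (\<bar>c\<bar> * l) * c\<bar> = \<bar>1 / l\<bar>"
    using assms(1) by (simp add: abs_mult)
  then show ?thesis
    using assms(2) modular_scale_abs[of "1 / (\<bar>c\<bar> * l) * c" x] modular_scale_abs[of "1 / l" x]
    by (simp only: seq_scale_scale)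
qed

lemma scale_in_space:
  assumes "x \<in> V"
  shows "seq_scale c x \<in> V"
proof (cases "c = 0")
  case True
  then have "seq_scale c x = 0" by (simp add: seq_scale_def fun_eq_iff)
  then show ?thesis by (simp add: zero_in_space)
next
  case False
  obtain l where "0 < l" "M (seq_scale (1 / l) x) \<le> 1"
    using assms by (auto simp: cesaro_orlicz_iff)
  then show ?thesis
    using False modular_scaled_le_one[of c l x]
    unfolding cesaro_orlicz_iff by (intro exI[of _ "\<bar>c\<bar> * l"]) simp
qed

lemma norm_scale_le:
  assumes "x \<in> V" "c \<noteq> 0"
  shows "N (seq_scale c x) \<le> \<bar>c\<bar> * N x"
proof -
  have c: "0 < \<bar>c\<bar>" using assms(2) by simp
  \<comment> \<open>Dividing by the absolute value of \<open>c\<close> isolates \<open>N x\<close>,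
    so that it suffices to compare with every \<open>l\<close> above it.\<close>
  have "N (seq_scale c x) / \<bar>c\<bar> \<le> N x"
  proof (rule dense_ge)
    fix l assume l: "N x < l"
    then have "0 < l" using norm_nonneg[OF assms(1)] by simp
    then have "N (seq_scale c x) \<le> \<bar>c\<bar> * l"
      using c by (intro norm_le[OF _ modular_scaled_le_one[OF assms(2) modular_le_one[OF assms(1) l]]]) simp
    then show "N (seq_scale c x) / \<bar>c\<bar> \<le> l"
      by (simp only: pos_divide_le_eq[OF c] mult.commute)
  qed
  then show ?thesis
    by (simp only: pos_divide_le_eq[OF c] mult.commute)
qed

lemma norm_scale:
  assumes "x \<in> V"
  shows "N (seq_scale c x) = \<bar>c\<bar> * N x"
proof (cases "c = 0")
  case True
  then have "seq_scale c x = 0" by (simp add: seq_scale_def fun_eq_iff)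
  then show ?thesis using True by (simp add: norm_zero)
next
  case False
  \<comment> \<open>The reverse inequality is \<open>norm_scale_le\<close> applied to the inverse
    scaling.\<close>
  have "N x = N (seq_scale (1 / c) (seq_scale c x))"
    using False by (simp add: seq_scale_scale seq_scale_one)
  also have "\<dots> \<le> \<bar>1 / c\<bar> * N (seq_scale c x)"
    using False by (intro norm_scale_le scale_in_space assms) simp
  finally have "\<bar>c\<bar> * N x \<le> \<bar>c\<bar> * (\<bar>1 / c\<bar> * N (seq_scale c x))"
    by (rule mult_left_mono) simp
  then have "\<bar>c\<bar> * N x \<le> N (seq_scale c x)"
    using False by simp
  then show ?thesis using norm_scale_le[OF assms False] by simp
qed

text \<open>The scaled sum is the convex combination of \<open>x / a\<close> and
  \<open>y / b\<close> with weights \<open>a / (a + b)\<close> and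
  \<open>b / (a + b)\<close>.\<close>

lemma modular_add_le_one:
  assumes "0 < a" "0 < b" "M (seq_scale (1 / a) x) \<le> 1" "M (seq_scale (1 / b) y) \<le> 1"
  shows "M (seq_scale (1 / (a + b)) (x + y)) \<le> 1"
proof -
  let ?s = "a / (a + b)" and ?t = "b / (a + b)"
  have st: "0 \<le> ?s" "0 \<le> ?t" "?s + ?t = 1"
    using assms(1,2) by (auto simp: add_divide_distrib[symmetric])
  have "seq_scale (1 / (a + b)) (x + y)
      = seq_scale ?s (seq_scale (1 / a) x) + seq_scale ?t (seq_scale (1 / b) y)"
    using assms(1,2) by (simp add: seq_scale_def fun_eq_iff add_divide_distrib)
  then have "M (seq_scale (1 / (a + b)) (x + y))
      \<le> ennreal ?s * M (seq_scale (1 / a) x) + ennreal ?t * M (seq_scale (1 / b) y)"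
    using modular_convex[OF st] by simp
  also have "\<dots> \<le> ennreal ?s * 1 + ennreal ?t * 1"
    by (intro add_mono mult_left_mono assms) auto
  also have "\<dots> = ennreal (?s + ?t)"
    using st(1,2) by (simp only: mult_1_right ennreal_plus)
  also have "\<dots> = 1"
    unfolding st(3) by simp
  finally show ?thesis .
qed

lemma add_in_space:
  assumes "x \<in> V" "y \<in> V"
  shows "x + y \<in> V"
proof -
  obtain a b where "0 < a" "0 < b" "M (seq_scale (1 / a) x) \<le> 1" "M (seq_scale (1 / b) y) \<le> 1"
    using assms by (auto simp: cesaro_orlicz_iff)
  then show ?thesis
    using modular_add_le_one[of a b x y] unfolding cesaro_orlicz_iff
    by (intro exI[of _ "a + b"]) simp
qed

lemma norm_add_le:
  assumes "x \<in> V" "y \<in> V"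
  shows "N (x + y) \<le> N x + N y"
proof (rule field_le_epsilon)
  fix e :: real assume "0 < e"
  \<comment> \<open>The slack \<open>e / 2\<close> puts both numbers strictly above the norms, where
    \<open>modular_le_one\<close> applies.\<close>
  then have pos: "0 < N x + e / 2" "0 < N y + e / 2"
    using norm_nonneg[OF assms(1)] norm_nonneg[OF assms(2)] by simp_all
  have "M (seq_scale (1 / (N x + e / 2)) x) \<le> 1" "M (seq_scale (1 / (N y + e / 2)) y) \<le> 1"
    using assms \<open>0 < e\<close> by (simp_all add: modular_le_one)
  then have "N (x + y) \<le> (N x + e / 2) + (N y + e / 2)"
    by (intro norm_le[OF add_pos_pos] modular_add_le_one pos)
  then show "N (x + y) \<le> N x + N y + e" by simp
qed

lemma subspace_cesaro_orlicz: "module.subspace seq_scale V"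
  by (simp add: module.subspace_def[OF module_seq_scale] zero_in_space add_in_space scale_in_space)

section \<open>Control of coordinates and completeness\<close>

lemma diff_in_space:
  assumes "x \<in> V" "y \<in> V"
  shows "x - y \<in> V"
  using module.subspace_diff[OF module_seq_scale subspace_cesaro_orlicz assms] .

text \<open>The bound is uniform in \<open>x\<close> for each fixed \<open>i\<close>, so it serves
  both definiteness of the norm and pointwise convergence of Cauchy sequences.\<close>

lemma coordinate_le_norm: "\<exists>u>0. \<forall>x\<in>V. \<forall>i. \<bar>x i\<bar> \<le> real (i + 1) * u * N x"
proof -
  obtain u where u: "0 < u" "1 < \<phi> u"
    using exists_phi_gt_one by blast
  have "\<bar>x i\<bar> \<le> real (i + 1) * u * N x" if "x \<in> V" for x i
  proof -
    have "cesaro_mean x i / u \<le> N x"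
    proof (rule dense_ge)
      fix l assume l: "N x < l"
      then have "0 < l" using norm_nonneg[OF that] by simp
      \<comment> \<open>A single term is bounded by the whole series. A mean above \<open>u\<close>
        would make this term at least \<open>\<phi> u\<close>, which exceeds 1.\<close>
      have "\<phi> (cesaro_mean (seq_scale (1 / l) x) i) \<le> M (seq_scale (1 / l) x)"
        unfolding cesaro_modular_def
        using sum_le_suminf[of "\<lambda>n. \<phi> (cesaro_mean (seq_scale (1 / l) x) n)" "{i}"]
        by (simp add: summableI)
      also have "\<dots> < \<phi> u"
        using modular_le_one[OF that l] u(2) by simp
      finally have "cesaro_mean (seq_scale (1 / l) x) i \<le> u"
        using phi_mono[of u "cesaro_mean (seq_scale (1 / l) x) i"] u(1) by (meson leD le_cases less_imp_le)
      then show "cesaro_mean x i / u \<le> l"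
        using \<open>0 < l\<close> u(1) by (simp add: cesaro_mean_scale field_simps)
    qed
    then have "cesaro_mean x i \<le> u * N x"
      using u(1) by (simp only: pos_divide_le_eq mult.commute)
    then have "real (i + 1) * cesaro_mean x i \<le> real (i + 1) * (u * N x)"
      by (rule mult_left_mono) simp
    then show ?thesis
      using abs_le_cesaro_mean[of x i] by (simp only: mult.assoc)
  qed
  then show ?thesis using u(1) by blast
qed

lemma norm_eq_zero_iff:
  assumes "x \<in> V"
  shows "N x = 0 \<longleftrightarrow> x = 0"
proof
  assume "N x = 0"
  then have "\<bar>x i\<bar> \<le> 0" for i
    using coordinate_le_norm assms by fastforce
  then show "x = 0" by (simp add: fun_eq_iff)
qed (simp add: norm_zero)

text \<open>Halving makes each nonzero mean of \<open>y\<close> strictly smaller than its limit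
  value, so the means of \<open>z k\<close> eventually dominate it. Each partial sum involves
  finitely many means, and one \<open>k\<close> serves them all.\<close>

lemma modular_half_limit_le_one:
  assumes lim: "\<And>j. (\<lambda>k. z k j) \<longlonglongrightarrow> y j"
    and bound: "eventually (\<lambda>k. M (z k) \<le> 1) sequentially"
  shows "M (seq_scale (1 / 2) y) \<le> 1"
  unfolding cesaro_modular_def
proof (rule suminf_le_const[OF summableI])
  fix J
  have "eventually (\<lambda>k. cesaro_mean (seq_scale (1 / 2) y) n \<le> cesaro_mean (z k) n) sequentially" for n
  proof (cases "cesaro_mean y n = 0")
    \<comment> \<open>Halving a zero mean gives no strict inequality, but then the claim is just
      nonnegativity of the means of \<open>z k\<close>.\<close>
    case True
    then show ?thesis by (simp add: cesaro_mean_scale cesaro_mean_nonneg)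
  next
    case False
    then have "cesaro_mean (seq_scale (1 / 2) y) n < cesaro_mean y n"
      using cesaro_mean_nonneg[of y n] by (simp add: cesaro_mean_scale)
    then have "eventually (\<lambda>k. cesaro_mean (seq_scale (1 / 2) y) n < cesaro_mean (z k) n) sequentially"
      by (rule order_tendstoD(1)[OF tendsto_cesaro_mean[where s = z and x = y, OF lim]])
    then show ?thesis by (rule eventually_mono) simp
  qed
  then have "eventually (\<lambda>k. \<forall>n\<in>{..<J}.
      cesaro_mean (seq_scale (1 / 2) y) n \<le> cesaro_mean (z k) n) sequentially"
    by (simp add: eventually_ball_finite)
  from eventually_conj[OF this bound]
  obtain k where k: "\<forall>n\<in>{..<J}. cesaro_mean (seq_scale (1 / 2) y) n \<le> cesaro_mean (z k) n"
    "M (z k) \<le> 1"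
    using eventually_happens'[OF sequentially_bot] by blast
  have "(\<Sum>n<J. \<phi> (cesaro_mean (seq_scale (1 / 2) y) n)) \<le> (\<Sum>n<J. \<phi> (cesaro_mean (z k) n))"
    using k(1) by (intro sum_mono phi_mono cesaro_mean_nonneg) auto
  also have "\<dots> \<le> M (z k)"
    unfolding cesaro_modular_def by (rule sum_le_suminf) (auto intro: summableI)
  also note k(2)
  finally show "(\<Sum>n<J. \<phi> (cesaro_mean (seq_scale (1 / 2) y) n)) \<le> 1" .
qed

lemma cauchy_coordinates:
  assumes sV: "\<And>k. s k \<in> V"
    and cauchy: "\<And>e. 0 < e \<Longrightarrow> \<exists>K. \<forall>m\<ge>K. \<forall>n\<ge>K. N (s m - s n) < e"
  shows "Cauchy (\<lambda>k. s k i)"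
proof (rule metric_CauchyI)
  fix e :: real assume "0 < e"
  obtain u where u: "0 < u" "\<And>x i. x \<in> V \<Longrightarrow> \<bar>x i\<bar> \<le> real (i + 1) * u * N x"
    using coordinate_le_norm by blast
  define c where "c = real (i + 1) * u"
  have "0 < c" using u(1) by (simp add: c_def)
  then obtain K where K: "\<forall>m\<ge>K. \<forall>n\<ge>K. N (s m - s n) < e / c"
    using cauchy[of "e / c"] \<open>0 < e\<close> by auto
  have "dist (s m i) (s n i) < e" if "K \<le> m" "K \<le> n" for m n
  proof -
    have "\<bar>(s m - s n) i\<bar> \<le> c * N (s m - s n)"
      using u(2) diff_in_space sV unfolding c_def by blast
    also have "\<dots> < e"
      using K that \<open>0 < c\<close> by (simp add: less_divide_eq mult.commute)
    finally show ?thesis by (simp add: dist_real_def)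
  qed
  then show "\<exists>K. \<forall>m\<ge>K. \<forall>n\<ge>K. dist (s m i) (s n i) < e" by blast
qed

lemma complete:
  assumes sV: "\<And>k. s k \<in> V"
    and cauchy: "\<And>e. 0 < e \<Longrightarrow> \<exists>K. \<forall>m\<ge>K. \<forall>n\<ge>K. N (s m - s n) < e"
  shows "\<exists>x\<in>V. (\<lambda>k. N (s k - x)) \<longlonglongrightarrow> 0"
proof -
  have "convergent (\<lambda>k. s k i)" for i
    using cauchy_coordinates[OF assms] by (rule real_Cauchy_convergent)
  then obtain x where x: "\<And>i. (\<lambda>k. s k i) \<longlonglongrightarrow> x i"
    unfolding convergent_def by metis
  have near: "\<exists>K. \<forall>m\<ge>K. s m - x \<in> V \<and> N (s m - x) \<le> 2 * e" if "0 < e" for e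
  proof -
    obtain K where K: "\<forall>m\<ge>K. \<forall>n\<ge>K. N (s m - s n) < e"
      using cauchy[OF \<open>0 < e\<close>] by blast
    have "s m - x \<in> V \<and> N (s m - x) \<le> 2 * e" if "K \<le> m" for m
    proof -
      \<comment> \<open>With \<open>m\<close> fixed, the differences \<open>s m - s k\<close> scaled
        by \<open>1 / e\<close> converge pointwise in \<open>k\<close> and have modular at most 1
        once \<open>k\<close> reaches \<open>K\<close>. The factor \<open>1 / 2\<close> is the
        source of \<open>2 * e\<close>.\<close>
      have "M (seq_scale (1 / 2) (seq_scale (1 / e) (s m - x))) \<le> 1"
      proof (rule modular_half_limit_le_one)
        show "(\<lambda>k. seq_scale (1 / e) (s m - s k) j) \<longlonglongrightarrow> seq_scale (1 / e) (s m - x) j" for j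
          unfolding seq_scale_def fun_diff_def by (intro tendsto_intros x)
        show "eventually (\<lambda>k. M (seq_scale (1 / e) (s m - s k)) \<le> 1) sequentially"
          unfolding eventually_sequentially using K that
          by (intro exI[of _ K] allI impI modular_le_one diff_in_space sV) simp
      qed
      then have "M (seq_scale (1 / (2 * e)) (s m - x)) \<le> 1"
        by (simp add: seq_scale_scale)
      moreover have "0 < 2 * e" using \<open>0 < e\<close> by simp
      ultimately show ?thesis
        using norm_le cesaro_orlicz_iff by blast
    qed
    then show ?thesis by blast
  qed
  obtain m where "s m - x \<in> V"
    using near[of 1] by auto
  \<comment> \<open>The limit is \<open>s m - (s m - x)\<close>, a difference of two
    members.\<close>
  then have "x \<in> V"
    using diff_in_space[OF sV[of m], of "s m - x"] by simp
  moreover have "(\<lambda>k. N (s k - x)) \<longlonglongrightarrow> 0"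
  proof (rule LIMSEQ_I)
    fix r :: real assume "0 < r"
    \<comment> \<open>The choice \<open>r / 4\<close> gives the bound \<open>r / 2\<close>, strictly
      below \<open>r\<close>.\<close>
    then obtain K where "\<forall>m\<ge>K. s m - x \<in> V \<and> N (s m - x) \<le> 2 * (r / 4)"
      using near[of "r / 4"] by auto
    then show "\<exists>K. \<forall>m\<ge>K. norm (N (s m - x) - 0) < r"
      using norm_nonneg \<open>0 < r\<close> by (intro exI[of _ K]) fastforce
  qed
  ultimately show ?thesis by blast
qed

lemma banach_space_cesaro_orlicz: "banach_space_on seq_scale V N"
  unfolding banach_space_on_def normed_space_on_def
  using vector_space_seq_scale subspace_cesaro_orlicz norm_nonneg norm_eq_zero_iff norm_scale
    norm_add_le complete
  by simp

end

theorem mainTheorem3: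
  fixes \<phi> :: "real \<Rightarrow> ennreal"
  assumes "orlicz_function \<phi>"
    and "cesaro_orlicz \<phi> \<noteq> {0}"
  shows "banach_space_on seq_scale (cesaro_orlicz \<phi>) (luxemburg_norm \<phi>)"
proof -
  interpret orlicz \<phi>
    using assms(1) by (rule orlicz.intro)
  show ?thesis by (rule banach_space_cesaro_orlicz)
qed

end
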